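(* Let $f^{\{1\}},\dots,f^{\{N\}}:\mathbb{R}^d\to\mathbb{R}^d$ be coercive component functions, i.e., for a common scalar product $\langle\cdot,\cdot\rangle$ on $\mathbb{R}^d$ with associated norm $\|\cdot\|$, there are $\mu^{\{m\}}<0$ with $$\big\langle f^{\{m\}}(y)-f^{\{m\}}(z),\,y-z\big\rangle\le \mu^{\{m\}}\big\|f^{\{m\}}(y)-f^{\{m\}}(z)\big\|^2\qquad\text{for all }y,z\in\mathbb{R}^d,\ m=1,\dots,N.$$ Consider the partitioned system $y'=\sum_{m=1}^N f^{\{m\}}(y)$ solved by a GARK method. Assume that there exist $r^{\{m\}}\ge 0$, $m=1,\dots,N$, such that the matrix $$\widetilde{\mathbf{P}}=\mathbf{P}+\mathrm{diag}_{m=1,\dots,N}\big\{r^{\{m\}}\mathbf{B}^{\{m\}}\big\}\ \ge\ 0$$ is non-negative definite. Then the solution is conditionally nonlinearly stable, in the sense that for any two numerical solutions $y_n\mapsto y_{n+1}$, $\widetilde y_n\mapsto\widetilde y_{n+1}$ computed with the same step size $h>0$, $$\|\widetilde y_{n+1}-y_{n+1}\|\le\|\widetilde y_n-y_n\|,$$ under the step size restriction $$h\le\min_{m=1,\dots,N}\frac{-2\mu^{\{m\}}}{r^{\{m\}}}$$ (a quotient with $r^{\{m\}}=0$ being read as $+\infty$).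
   Context: GARK (generalized additively partitioned Runge-Kutta) method: with real coefficients $\mathbf{A}^{\{q,m\}}=(a_{i,j}^{\{q,m\}})\in\mathbb{R}^{s^{\{q\}}\times s^{\{m\}}}$, $\mathbf{b}^{\{q\}}=(b_i^{\{q\}})\in\mathbb{R}^{s^{\{q\}}}$, $q,m=1,\dots,N$, one step of size $h$ applied to $y'=\sum_{m=1}^N f^{\{m\}}(y)$ is $$Y_i^{\{q\}} = y_n + h\sum_{m=1}^N\sum_{j=1}^{s^{\{m\}}} a_{i,j}^{\{q,m\}} f^{\{m\}}\big(Y_j^{\{m\}}\big),\quad i=1,\dots,s^{\{q\}},\ q=1,\dots,N,$$ $$y_{n+1}=y_n+h\sum_{q=1}^N\sum_{i=1}^{s^{\{q\}}} b_i^{\{q\}} f^{\{q\}}\big(Y_i^{\{q\}}\big).$$ A numerical solution means values $Y_i^{\{q\}}, y_{n+1}$ satisfying these equations. Define $\mathbf{B}^{\{m\}}=\mathrm{diag}(\mathbf{b}^{\{m\}})$ and, for $m,\ell=1,\dots,N$, $$\mathbf{P}^{\{m,\ell\}}=(\mathbf{A}^{\{\ell,m\}})^T\mathbf{B}^{\{\ell\}}+\mathbf{B}^{\{m\}}\mathbf{A}^{\{m,\ell\}}-\mathbf{b}^{\{m\}}(\mathbf{b}^{\{\ell\}})^T\in\mathbb{R}^{s^{\{m\}}\times s^{\{\ell\}}},$$ and let $\mathbf{P}=[\mathbf{P}^{\{\ell,m\}}]_{1\le\ell,m\le N}\in\mathbb{R}^{s\times s}$, $s=\sum_{q=1}^N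 s^{\{q\}}$, a symmetric block matrix. $\mathrm{diag}_{m=1,\dots,N}\{r^{\{m\}}\mathbf{B}^{\{m\}}\}$ is the block diagonal matrix with diagonal blocks $r^{\{m\}}\mathbf{B}^{\{m\}}$.
   Formalization: The formal theorem additionally assumes all weights b_i^{q} ≥ 0; without this the claim fails, e.g. N = s = d = 1, A = (−1), b = (−1), r = 0, f(y) = −y, h = 1/2 gives P = 1 ≥ 0 but y_{n+1} = 2 y_n. *)

theory Defs
  imports "HOL-Analysis.Analysis" "Jordan_Normal_Form.Matrix"
begin

(* $ and \<bullet> denote the Jordan_Normal_Form operations, not their HOL-Analysis namesakes. *)
unbundle no vec_syntax
no_notation inner (infix "\<bullet>" 70)

definition is_scalar_product :: "('v::real_vector \<Rightarrow> 'v \<Rightarrow> real) \<Rightarrow> bool" where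
  "is_scalar_product ip \<longleftrightarrow>
     bilinear ip \<and> (\<forall>x y. ip x y = ip y x) \<and> (\<forall>x. x \<noteq> 0 \<longrightarrow> 0 < ip x x)"

definition ip_norm :: "('v::real_vector \<Rightarrow> 'v \<Rightarrow> real) \<Rightarrow> 'v \<Rightarrow> real" where
  "ip_norm ip x = sqrt (ip x x)"

definition coercive ::
    "('v::real_vector \<Rightarrow> 'v \<Rightarrow> real) \<Rightarrow> ('v \<Rightarrow> 'v) \<Rightarrow> real \<Rightarrow> bool" where
  "coercive ip f \<mu> \<longleftrightarrow>
     \<mu> < 0 \<and> (\<forall>y z. ip (f y - f z) (y - z) \<le> \<mu> * (ip_norm ip (f y - f z))\<^sup>2)"

(* Partitions are numbered 0, ..., N-1, and the stages of partition q are 0, ..., s q - 1. *)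
definition gark_coefficients ::
    "nat \<Rightarrow> (nat \<Rightarrow> nat) \<Rightarrow> (nat \<Rightarrow> nat \<Rightarrow> real mat) \<Rightarrow> (nat \<Rightarrow> real vec) \<Rightarrow> bool" where
  "gark_coefficients N s A b \<longleftrightarrow>
     (\<forall>q<N. b q \<in> carrier_vec (s q)) \<and> (\<forall>q<N. \<forall>m<N. A q m \<in> carrier_mat (s q) (s m))"

definition gark_step ::
    "nat \<Rightarrow> (nat \<Rightarrow> nat) \<Rightarrow> (nat \<Rightarrow> nat \<Rightarrow> real mat) \<Rightarrow> (nat \<Rightarrow> real vec) \<Rightarrow>
     (nat \<Rightarrow> 'v \<Rightarrow> 'v::real_vector) \<Rightarrow> real \<Rightarrow> 'v \<Rightarrow> (nat \<Rightarrow> nat \<Rightarrow> 'v) \<Rightarrow> 'v \<Rightarrow> bool" where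
  "gark_step N s A b f h y Y y' \<longleftrightarrow>
     (\<forall>q<N. \<forall>i<s q.
        Y q i = y + h *\<^sub>R (\<Sum>m<N. \<Sum>j<s m. (A q m $$ (i, j)) *\<^sub>R f m (Y m j))) \<and>
     y' = y + h *\<^sub>R (\<Sum>q<N. \<Sum>i<s q. (b q $ i) *\<^sub>R f q (Y q i))"

(* Sign condition on the weights, as usual for algebraically stable methods. The stability theorem
   needs it in addition to the condition on the matrix P_tilde: for N = 1 and one stage with
   A = (-1), b = (-1) one has P = (1), yet the step applied to the coercive function f(y) = -y
   with h = 1/2 is y' = 2 y, although r = 0 leaves h unrestricted. *)
definition nonneg_weights :: "nat \<Rightarrow> (nat \<Rightarrow> nat) \<Rightarrow> (nat \<Rightarrow> real vec) \<Rightarrow> bool" where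
  "nonneg_weights N s b \<longleftrightarrow> (\<forall>q<N. \<forall>i<s q. 0 \<le> b q $ i)"

definition weight_mat :: "(nat \<Rightarrow> real vec) \<Rightarrow> nat \<Rightarrow> real mat" where
  "weight_mat b m = mat_diag (dim_vec (b m)) (\<lambda>i. b m $ i)"

definition outer_prod :: "real vec \<Rightarrow> real vec \<Rightarrow> real mat" where
  "outer_prod u v = mat (dim_vec u) (dim_vec v) (\<lambda>(i, j). u $ i * v $ j)"

definition P_block ::
    "(nat \<Rightarrow> nat \<Rightarrow> real mat) \<Rightarrow> (nat \<Rightarrow> real vec) \<Rightarrow> nat \<Rightarrow> nat \<Rightarrow> real mat" where
  "P_block A b m l =
     transpose_mat (A l m) * weight_mat b l + weight_mat b m * A m l - outer_prod (b m) (b l)"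

definition block_offset :: "(nat \<Rightarrow> nat) \<Rightarrow> nat \<Rightarrow> nat" where
  "block_offset s q = (\<Sum>p<q. s p)"

(* The partition q with block_offset s q \<le> k < block_offset s (q + 1). *)
definition block_of :: "(nat \<Rightarrow> nat) \<Rightarrow> nat \<Rightarrow> nat" where
  "block_of s k = (LEAST q. k < block_offset s (Suc q))"

definition block_mat ::
    "nat \<Rightarrow> (nat \<Rightarrow> nat) \<Rightarrow> (nat \<Rightarrow> nat \<Rightarrow> real mat) \<Rightarrow> real mat" where
  "block_mat N s M = mat (block_offset s N) (block_offset s N)
     (\<lambda>(i, j). M (block_of s i) (block_of s j) $$
        (i - block_offset s (block_of s i), j - block_offset s (block_of s j)))"

definition P_mat ::
    "nat \<Rightarrow> (nat \<Rightarrow> nat) \<Rightarrow> (nat \<Rightarrow> nat \<Rightarrow> real mat) \<Rightarrow> (nat \<Rightarrow> real vec) \<Rightarrow> real mat" where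
  "P_mat N s A b = block_mat N s (P_block A b)"

definition P_tilde ::
    "nat \<Rightarrow> (nat \<Rightarrow> nat) \<Rightarrow> (nat \<Rightarrow> nat \<Rightarrow> real mat) \<Rightarrow> (nat \<Rightarrow> real vec) \<Rightarrow> (nat \<Rightarrow> real) \<Rightarrow> real mat"
  where
  "P_tilde N s A b r =
     P_mat N s A b + diag_block_mat (map (\<lambda>m. r m \<cdot>\<^sub>m weight_mat b m) [0..<N])"

(* Not the entrywise order that Jordan_Normal_Form attaches to 0 \<le> M. *)
definition nonneg_definite :: "real mat \<Rightarrow> bool" where
  "nonneg_definite M \<longleftrightarrow>
     square_mat M \<and> (\<forall>v \<in> carrier_vec (dim_row M). 0 \<le> v \<bullet> (M *\<^sub>v v))"

(* In ereal, c / 0 = \<infinity> for c > 0, so the terms with r m = 0 impose no restriction. *)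
definition step_bound :: "nat \<Rightarrow> (nat \<Rightarrow> real) \<Rightarrow> (nat \<Rightarrow> real) \<Rightarrow> ereal" where
  "step_bound N \<mu> r = (MIN m\<in>{..<N}. ereal (- 2 * \<mu> m) / ereal (r m))"

end

theory Submission
  imports Defs
begin

text \<open>
  Numbering all stages of all partitions together turns the method into one Runge-Kutta scheme
  whose stage \<open>k = (q, i)\<close> evaluates its own function \<open>f q\<close>. For two
  numerical solutions let \<open>D\<close> and \<open>D'\<close> be their differences before and
  after the step, \<open>W k\<close> the difference of the stage values and \<open>K k\<close> that
  of the function values. Expanding the square of the norm of \<open>D'\<close> and eliminating
  \<open>D\<close> from the mixed terms by means of the stage equations gives Burrage and Butcher's
  identity (\<open>energy_balance\<close>): the squared norm grows by
  \<open>2 h \<Sum> w k \<langle>K k, W k\<rangle> - h\<^sup>2 \<Sum>\<Sum> P k l \<langle>K k, K l\<rangle>\<close>,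
  where the \<open>P k l\<close> are exactly the entries of the block matrix \<open>P_mat\<close>.

  The second sum is controlled by the matrix hypothesis: a non-negative quadratic form stays
  non-negative when products of numbers are replaced by scalar products of vectors
  (\<open>gram_sum_nonneg\<close>), so the double sum is at least
  \<open>- \<Sum> r w k \<langle>K k, K k\<rangle>\<close>. The first sum is controlled by coercivity:
  as the weights are non-negative, it is at most
  \<open>\<Sum> \<mu> w k \<langle>K k, K k\<rangle>\<close>. The growth is therefore at most
  \<open>h \<Sum> (2 \<mu> + h r) w k \<langle>K k, K k\<rangle>\<close>, and the step size restriction
  says that each factor \<open>2 \<mu> + h r\<close> is non-positive.
\<close>

section \<open>Gram sums of quadratic forms\<close>

text \<open>
  With coordinates in an orthonormal basis the sum splits into one value of the quadratic form per
  coordinate. The induction produces such coordinates one at a time, as in the Gram-Schmidt process: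
  splitting off the components along one of the vectors, say
  \<open>x n\<close>, contributes a value of the form times the square of the norm of
  \<open>x n\<close>, and replaces \<open>x n\<close> by zero, which removes the index \<open>n\<close>.
\<close>

lemma gram_sum_nonneg:
  fixes ip :: "'v::real_vector \<Rightarrow> 'v \<Rightarrow> real" and M :: "'i \<Rightarrow> 'i \<Rightarrow> real"
  assumes ip: "is_scalar_product ip"
    and "finite I"
    and "\<And>c. 0 \<le> (\<Sum>k\<in>I. \<Sum>l\<in>I. M k l * (c k * c l))"
  shows "0 \<le> (\<Sum>k\<in>I. \<Sum>l\<in>I. M k l * ip (x k) (x l))"
  using \<open>finite I\<close> assms(3)
proof (induction I arbitrary: x rule: finite_induct)
  case empty
  then show ?case by simp
next
  case (insert n I)
  have bil: "bilinear ip" and sym: "\<And>u v. ip u v = ip v u"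
    and pos: "\<And>u. u \<noteq> 0 \<Longrightarrow> 0 < ip u u"
    using ip by (auto simp: is_scalar_product_def)
  define u where "u = x n"
  \<comment> \<open>If \<open>u = 0\<close>, then \<open>c = 0\<close> because division by zero gives zero, and the splitting is trivial.\<close>
  define c where "c k = ip (x k) u / ip u u" for k
  define x' where "x' k = x k - c k *\<^sub>R u" for k
  have nonneg: "0 \<le> ip u u"
    using pos[of u] bilinear_lzero[OF bil] by (cases "u = 0") auto
  have x: "x k = c k *\<^sub>R u + x' k" for k
    by (simp add: x'_def)
  have orth: "ip (x' k) u = 0" for k
    using pos[of u] bilinear_rzero[OF bil]
    by (cases "u = 0") (auto simp: x'_def c_def bilinear_lsub[OF bil] bilinear_lmul[OF bil])
  have orth': "ip u (x' k) = 0" for k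
    using orth[of k] sym[of u "x' k"] by simp
  have "x' n = 0"
    using pos[of u] by (cases "u = 0") (auto simp: x'_def c_def u_def)
  have pythagoras: "ip (x k) (x l) = c k * c l * ip u u + ip (x' k) (x' l)" for k l
    by (subst (1 2) x)
      (simp add: bilinear_ladd[OF bil] bilinear_radd[OF bil] bilinear_lmul[OF bil]
        bilinear_rmul[OF bil] orth orth')
  \<comment> \<open>Vectors of coefficients that vanish at \<open>n\<close> carry the hypothesis over to the smaller index set.\<close>
  have restrict: "0 \<le> (\<Sum>k\<in>I. \<Sum>l\<in>I. M k l * (d k * d l))" for d
  proof -
    have "(\<Sum>k\<in>I. \<Sum>l\<in>I. M k l * ((d(n := 0)) k * (d(n := 0)) l))
        = (\<Sum>k\<in>I. \<Sum>l\<in>I. M k l * (d k * d l))"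
      using insert.hyps by (intro sum.cong refl) auto
    then show ?thesis
      using insert.prems[of "d(n := 0)"] insert.hyps by simp
  qed
  have "(\<Sum>k\<in>insert n I. \<Sum>l\<in>insert n I. M k l * ip (x k) (x l))
      = ip u u * (\<Sum>k\<in>insert n I. \<Sum>l\<in>insert n I. M k l * (c k * c l))
        + (\<Sum>k\<in>insert n I. \<Sum>l\<in>insert n I. M k l * ip (x' k) (x' l))"
    unfolding sum_distrib_left sum.distrib[symmetric] pythagoras
    by (intro sum.cong refl) (simp add: algebra_simps)
  also have "(\<Sum>k\<in>insert n I. \<Sum>l\<in>insert n I. M k l * ip (x' k) (x' l))
      = (\<Sum>k\<in>I. \<Sum>l\<in>I. M k l * ip (x' k) (x' l))"
    using insert.hyps
    by (simp add: \<open>x' n = 0\<close> bilinear_lzero[OF bil] bilinear_rzero[OF bil])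
  finally show ?case
    using insert.IH[OF restrict, of x'] insert.prems[of c] nonneg by simp
qed

section \<open>The energy balance of a Runge-Kutta step\<close>

text \<open>
  Substituting \<open>D = W k - h \<Sum> a k l K l\<close> into the mixed terms \<open>\<langle>K k, D\<rangle>\<close>
  matters because coercivity speaks about \<open>\<langle>K k, W k\<rangle>\<close>. The double sum \<open>S\<close> this
  creates appears with the factor 2; writing one of the two copies with \<open>k\<close> and \<open>l\<close>
  exchanged yields the symmetric coefficients of the algebraic stability matrix.
\<close>

lemma energy_balance:
  fixes ip :: "'v::real_vector \<Rightarrow> 'v \<Rightarrow> real"
  assumes ip: "is_scalar_product ip"
    and W: "\<And>k. k \<in> I \<Longrightarrow> W k = D + h *\<^sub>R (\<Sum>l\<in>I. a k l *\<^sub>R K l)"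
    and D': "D' = D + h *\<^sub>R (\<Sum>k\<in>I. w k *\<^sub>R K k)"
  shows "ip D' D' = ip D D + 2 * h * (\<Sum>k\<in>I. w k * ip (K k) (W k))
    - h\<^sup>2 * (\<Sum>k\<in>I. \<Sum>l\<in>I. (a l k * w l + w k * a k l - w k * w l) * ip (K k) (K l))"
proof -
  have bil: "bilinear ip" and sym: "\<And>u v. ip u v = ip v u"
    using ip by (auto simp: is_scalar_product_def)
  have rsum: "ip u (\<Sum>k\<in>I. c k *\<^sub>R K k) = (\<Sum>k\<in>I. c k * ip u (K k))" for u c
    using bil by (simp add: bilinear_def linear_sum linear_cmul)
  have lsum: "ip (\<Sum>k\<in>I. c k *\<^sub>R K k) u = (\<Sum>k\<in>I. c k * ip (K k) u)" for u c
    using rsum[of u c] by (simp add: sym)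
  define S where "S = (\<Sum>k\<in>I. \<Sum>l\<in>I. w k * a k l * ip (K k) (K l))"
  define Q where "Q = (\<Sum>k\<in>I. \<Sum>l\<in>I. w k * w l * ip (K k) (K l))"
  have WK: "(\<Sum>k\<in>I. w k * ip (K k) (W k)) = (\<Sum>k\<in>I. w k * ip (K k) D) + h * S"
    by (simp add: W bilinear_radd[OF bil] bilinear_rmul[OF bil] rsum S_def distrib_left
        sum.distrib sum_distrib_left mult_ac)
  have DD: "ip D' D' = ip D D + 2 * h * (\<Sum>k\<in>I. w k * ip (K k) D) + h\<^sup>2 * Q"
  proof -
    have "ip (\<Sum>k\<in>I. w k *\<^sub>R K k) (\<Sum>k\<in>I. w k *\<^sub>R K k) = Q"
      unfolding lsum rsum Q_def by (simp add: sum_distrib_left mult.assoc sym)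
    then show ?thesis
      unfolding D'
      by (simp add: bilinear_radd[OF bil] bilinear_rmul[OF bil] bilinear_ladd[OF bil]
          bilinear_lmul[OF bil] sym[of D "\<Sum>k\<in>I. w k *\<^sub>R K k"] lsum
          power2_eq_square algebra_simps)
  qed
  have P: "(\<Sum>k\<in>I. \<Sum>l\<in>I. (a l k * w l + w k * a k l - w k * w l) * ip (K k) (K l))
      = 2 * S - Q"
  proof -
    have "(\<Sum>k\<in>I. \<Sum>l\<in>I. a l k * w l * ip (K k) (K l)) = S"
      unfolding S_def by (subst sum.swap) (simp add: sym mult_ac)
    then show ?thesis
      by (simp add: S_def Q_def left_diff_distrib distrib_right sum.distrib sum_subtractf)
  qed
  show ?thesis
    unfolding DD WK P by (simp add: power2_eq_square algebra_simps)
qed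

section \<open>Entries of the block matrix\<close>

lemma block_offset_Suc: "block_offset s (Suc q) = block_offset s q + s q"
  by (simp add: block_offset_def)

lemma block_offset_mono: "p \<le> q \<Longrightarrow> block_offset s p \<le> block_offset s q"
  unfolding block_offset_def by (rule sum_mono2) auto

lemma block_offset_bound:
  assumes "q < N" "i < s q"
  shows "block_offset s q + i < block_offset s N"
  using block_offset_mono[of "Suc q" N s] assms by (simp add: block_offset_Suc)

lemma block_of_offset_add:
  assumes "i < s q"
  shows "block_of s (block_offset s q + i) = q"
  unfolding block_of_def
proof (rule Least_equality)
  show "block_offset s q + i < block_offset s (Suc q)"
    using assms by (simp add: block_offset_Suc)
  show "q \<le> p" if "block_offset s q + i < block_offset s (Suc p)" for p
    using that block_offset_mono[of "Suc p" q s] by (meson leI le_add1 le_trans not_less not_less_eq_eq)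
qed

lemma sum_block_offset:
  "(\<Sum>k<block_offset s N. g k) = (\<Sum>q<N. \<Sum>i<s q. g (block_offset s q + i))"
  for g :: "nat \<Rightarrow> 'a::comm_monoid_add"
proof (induction N)
  case 0
  then show ?case by (simp add: block_offset_def)
next
  case (Suc N)
  have "(\<Sum>k<a + n. g k) = (\<Sum>k<a. g k) + (\<Sum>i<n. g (a + i))" for a n
    by (induction n) (simp_all add: add.assoc)
  then show ?case using Suc by (simp add: block_offset_Suc)
qed

lemma index_block_mat:
  assumes "q < N" "m < N" "i < s q" "j < s m"
  shows "block_mat N s M $$ (block_offset s q + i, block_offset s m + j) = M q m $$ (i, j)"
  using assms by (simp add: block_mat_def block_offset_bound block_of_offset_add)

lemma diag_block_mat_carrier:
  assumes "\<And>m. m < N \<Longrightarrow> D m \<in> carrier_mat (s m) (s m)"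
  shows "diag_block_mat (map D [0..<N]) \<in> carrier_mat (block_offset s N) (block_offset s N)"
  using assms
proof (induction N)
  case 0
  then show ?case by (simp add: block_offset_def)
next
  case (Suc N)
  then have "diag_block_mat (map D [0..<N]) \<in> carrier_mat (block_offset s N) (block_offset s N)"
    and "D N \<in> carrier_mat (s N) (s N)" by auto
  then show ?case
    by (simp add: diag_block_mat_last block_offset_Suc Let_def)
qed

text \<open>
  The induction removes the last block, since all other blocks keep their offsets then.
\<close>

lemma index_diag_block_mat:
  assumes "\<And>m. m < N \<Longrightarrow> D m \<in> carrier_mat (s m) (s m)"
    and "q < N" "m < N" "i < s q" "j < s m"
  shows "diag_block_mat (map D [0..<N]) $$ (block_offset s q + i, block_offset s m + j)
    = (if q = m then D q $$ (i, j) else 0)"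
  using assms
proof (induction N)
  case 0
  then show ?case by simp
next
  case (Suc N)
  have E: "diag_block_mat (map D [0..<N]) \<in> carrier_mat (block_offset s N) (block_offset s N)"
    using Suc.prems(1) by (intro diag_block_mat_carrier) simp
  have DN: "D N \<in> carrier_mat (s N) (s N)"
    using Suc.prems(1) by simp
  show ?case
    using Suc.IH Suc.prems carrier_matD[OF E] carrier_matD[OF DN] block_offset_bound[of q N i s] block_offset_bound[of m N j s]
    by (cases "q = N"; cases "m = N") (auto simp: diag_block_mat_last Let_def)
qed

lemma weight_mat_carrier:
  assumes "gark_coefficients N s A b" "m < N"
  shows "weight_mat b m \<in> carrier_mat (s m) (s m)"
  using assms by (auto simp: gark_coefficients_def weight_mat_def mat_diag_def)

lemma index_P_block:
  assumes "gark_coefficients N s A b" "q < N" "m < N" "i < s q" "j < s m"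
  shows "P_block A b q m $$ (i, j)
    = A m q $$ (j, i) * b m $ j + b q $ i * A q m $$ (i, j) - b q $ i * b m $ j"
proof -
  have c: "A m q \<in> carrier_mat (s m) (s q)" "A q m \<in> carrier_mat (s q) (s m)"
    "dim_vec (b q) = s q" "dim_vec (b m) = s m"
    using assms by (auto simp: gark_coefficients_def)
  then have "transpose_mat (A m q) * mat_diag (s m) (\<lambda>i. b m $ i)
      = mat (s q) (s m) (\<lambda>(i, j). transpose_mat (A m q) $$ (i, j) * b m $ j)"
    by (intro mat_diag_mult_right) auto
  moreover from c have "mat_diag (s q) (\<lambda>i. b q $ i) * A q m
      = mat (s q) (s m) (\<lambda>(i, j). b q $ i * A q m $$ (i, j))"
    by (intro mat_diag_mult_left) auto
  ultimately show ?thesis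
    using assms c by (simp add: P_block_def weight_mat_def outer_prod_def)
qed

lemma index_P_tilde:
  assumes "gark_coefficients N s A b" "q < N" "m < N" "i < s q" "j < s m"
  shows "P_tilde N s A b r $$ (block_offset s q + i, block_offset s m + j)
    = A m q $$ (j, i) * b m $ j + b q $ i * A q m $$ (i, j) - b q $ i * b m $ j
      + (if (q, i) = (m, j) then r q * b q $ i else 0)"
proof -
  let ?D = "\<lambda>m. r m \<cdot>\<^sub>m weight_mat b m"
  have D: "?D m \<in> carrier_mat (s m) (s m)" if "m < N" for m
    using weight_mat_carrier[OF assms(1) that] by simp
  have "dim_vec (b q) = s q"
    using assms by (auto simp: gark_coefficients_def)
  then have "?D q $$ (i, j) = (if i = j then r q * b q $ i else 0)" if "q = m"
    using assms that by (auto simp: weight_mat_def mat_diag_def)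
  moreover have "diag_block_mat (map ?D [0..<N]) \<in> carrier_mat (block_offset s N) (block_offset s N)"
    by (rule diag_block_mat_carrier) (rule D)
  ultimately show ?thesis
    using assms block_offset_bound[of q N i s] block_offset_bound[of m N j s]
    by (auto simp: P_tilde_def P_mat_def index_block_mat index_P_block
        index_diag_block_mat[of N ?D, OF D])
qed

section \<open>The quadratic form in terms of stages\<close>

definition stages :: "nat \<Rightarrow> (nat \<Rightarrow> nat) \<Rightarrow> (nat \<times> nat) set" where
  "stages N s = (SIGMA q:{..<N}. {..<s q})"

lemma finite_stages: "finite (stages N s)"
  by (simp add: stages_def)

lemma sum_stages: "(\<Sum>k\<in>stages N s. g k) = (\<Sum>q<N. \<Sum>i<s q. g (q, i))"
  by (simp add: stages_def sum.Sigma)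

text \<open>
  Here the matrix hypothesis is rewritten with pairs of a partition and a stage as indices, in the
  form in which the coefficients of \<open>energy_balance\<close> appear: \<open>a\<close> and
  \<open>w\<close> are the tableau and the weights of the method read as a single Runge-Kutta scheme.
\<close>

lemma P_tilde_quadratic_form:
  assumes co: "gark_coefficients N s A b" and psd: "nonneg_definite (P_tilde N s A b r)"
  defines "a \<equiv> \<lambda>(q, i) (m, j). A q m $$ (i, j)" and "w \<equiv> \<lambda>(q, i). b q $ i"
  shows "0 \<le> (\<Sum>k\<in>stages N s. \<Sum>l\<in>stages N s.
    (a l k * w l + w k * a k l - w k * w l + (if k = l then r (fst k) * w k else 0)) * (c k * c l))"
proof -
  let ?n = "block_offset s N" and ?T = "P_tilde N s A b r"
  let ?E = "\<lambda>k. block_offset s (fst k) + snd k"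
  have "diag_block_mat (map (\<lambda>m. r m \<cdot>\<^sub>m weight_mat b m) [0..<N]) \<in> carrier_mat ?n ?n"
    using weight_mat_carrier[OF co] by (intro diag_block_mat_carrier) simp
  then have T: "?T \<in> carrier_mat ?n ?n"
    by (auto simp: P_tilde_def)
  \<comment> \<open>The coefficients \<open>c\<close> listed partition by partition; \<open>?E\<close> is the position of a stage in this list.\<close>
  define v where "v = vec ?n (\<lambda>k. c (block_of s k, k - block_offset s (block_of s k)))"
  have v: "v $ ?E k = c k" if "k \<in> stages N s" for k
    using that by (auto simp: stages_def v_def block_offset_bound block_of_offset_add)
  have entry: "?T $$ (?E k, ?E l) = a l k * w l + w k * a k l - w k * w l
      + (if k = l then r (fst k) * w k else 0)"
    if "k \<in> stages N s" "l \<in> stages N s" for k l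
    using that by (auto simp: stages_def a_def w_def index_P_tilde[OF co] split: if_splits)
  have "v \<bullet> (?T *\<^sub>v v) = (\<Sum>k<?n. \<Sum>l<?n. ?T $$ (k, l) * (v $ k * v $ l))"
    using T by (auto simp: scalar_prod_def v_def sum_distrib_left lessThan_atLeast0 mult_ac
        intro!: sum.cong)
  also have "\<dots> = (\<Sum>k\<in>stages N s. \<Sum>l\<in>stages N s. ?T $$ (?E k, ?E l) * (v $ ?E k * v $ ?E l))"
    by (simp add: sum_block_offset sum_stages)
  also have "\<dots> = (\<Sum>k\<in>stages N s. \<Sum>l\<in>stages N s.
      (a l k * w l + w k * a k l - w k * w l + (if k = l then r (fst k) * w k else 0)) * (c k * c l))"
    by (intro sum.cong refl) (simp only: entry v)
  finally have eq: "v \<bullet> (?T *\<^sub>v v) = \<dots>" .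
  have "v \<in> carrier_vec (dim_row ?T)"
    using T by (simp add: v_def)
  with psd have "0 \<le> v \<bullet> (?T *\<^sub>v v)"
    by (simp add: nonneg_definite_def)
  then show ?thesis
    by (simp only: eq)
qed

section \<open>Conditional nonlinear stability\<close>

text \<open>
  This form also covers \<open>r m = 0\<close>, where the quotient is infinite, and it is the form in which
  the bound meets the factor \<open>2 * \<mu> m + h * r m\<close> of the energy estimate.
\<close>

lemma step_bound_cleared:
  assumes "ereal h \<le> step_bound N \<mu> r" "m < N" "0 \<le> r m" "\<mu> m < 0"
  shows "h * r m \<le> - 2 * \<mu> m"
proof (cases "r m = 0")
  case True
  then show ?thesis using assms by simp
next
  case False
  have "step_bound N \<mu> r \<le> ereal (- 2 * \<mu> m) / ereal (r m)"
    unfolding step_bound_def using assms(2) by (intro Min_le) auto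
  with assms(1) have "ereal h \<le> ereal (- 2 * \<mu> m) / ereal (r m)"
    by (rule order_trans)
  with False have "h \<le> - 2 * \<mu> m / r m"
    by simp
  moreover have "0 < r m"
    using False assms(3) by simp
  ultimately show ?thesis
    by (simp only: pos_le_divide_eq)
qed

theorem theorem4p4:
  fixes ip :: "real ^ 'd \<Rightarrow> real ^ 'd \<Rightarrow> real"
    and f :: "nat \<Rightarrow> real ^ 'd \<Rightarrow> real ^ 'd"
    and N :: nat and s :: "nat \<Rightarrow> nat"
    and A :: "nat \<Rightarrow> nat \<Rightarrow> real mat" and b :: "nat \<Rightarrow> real vec"
    and \<mu> r :: "nat \<Rightarrow> real" and h :: real
    and y y' z z' :: "real ^ 'd" and Y Z :: "nat \<Rightarrow> nat \<Rightarrow> real ^ 'd"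
  assumes "N \<ge> 1"
    and "is_scalar_product ip"
    and "\<And>m. m < N \<Longrightarrow> coercive ip (f m) (\<mu> m)"
    and "gark_coefficients N s A b"
    and "nonneg_weights N s b"
    and "\<And>m. m < N \<Longrightarrow> r m \<ge> 0"
    and "nonneg_definite (P_tilde N s A b r)"
    and "h > 0"
    and "ereal h \<le> step_bound N \<mu> r"
    and "gark_step N s A b f h y Y y'"
    and "gark_step N s A b f h z Z z'"
  shows "ip_norm ip (z' - y') \<le> ip_norm ip (z - y)"
proof -
  let ?I = "stages N s"
  define a where "a = (\<lambda>(q, i) (m, j). A q m $$ (i, j))"
  define w where "w = (\<lambda>(q, i). b q $ i)"
  define W where "W = (\<lambda>(q, i). Z q i - Y q i)"
  define K where "K = (\<lambda>(q, i). f q (Z q i) - f q (Y q i))"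
  have Y: "Y q i = y + h *\<^sub>R (\<Sum>m<N. \<Sum>j<s m. (A q m $$ (i, j)) *\<^sub>R f m (Y m j))"
    and Z: "Z q i = z + h *\<^sub>R (\<Sum>m<N. \<Sum>j<s m. (A q m $$ (i, j)) *\<^sub>R f m (Z m j))"
    if "q < N" "i < s q" for q i
    using assms(10,11) that by (auto simp: gark_step_def)
  have stage: "W k = (z - y) + h *\<^sub>R (\<Sum>l\<in>?I. a k l *\<^sub>R K l)" if stage_k: "k \<in> ?I" for k
  proof -
    obtain q i where k: "k = (q, i)" "q < N" "i < s q"
      using stage_k by (cases k) (auto simp: stages_def)
    then show ?thesis
      using Y[of q i] Z[of q i]
      by (simp add: W_def a_def K_def sum_stages scaleR_diff_right sum_subtractf)
  qed
  have update: "z' - y' = (z - y) + h *\<^sub>R (\<Sum>k\<in>?I. w k *\<^sub>R K k)"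
    using assms(10,11)
    by (simp add: gark_step_def w_def K_def sum_stages scaleR_diff_right sum_subtractf)

  define M where "M k l = a l k * w l + w k * a k l - w k * w l" for k l
  have "0 \<le> (\<Sum>k\<in>?I. \<Sum>l\<in>?I. (M k l + (if k = l then r (fst k) * w k else 0)) * (c k * c l))" for c
    unfolding M_def a_def w_def by (rule P_tilde_quadratic_form[OF assms(4,7)])
  then have "0 \<le> (\<Sum>k\<in>?I. \<Sum>l\<in>?I.
      (M k l + (if k = l then r (fst k) * w k else 0)) * ip (K k) (K l))"
    by (rule gram_sum_nonneg[OF assms(2) finite_stages])
  also have "\<dots> = (\<Sum>k\<in>?I. \<Sum>l\<in>?I. M k l * ip (K k) (K l))
      + (\<Sum>k\<in>?I. r (fst k) * w k * ip (K k) (K k))"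
    by (simp add: distrib_right sum.distrib if_distrib[of "\<lambda>t. t * _"] finite_stages cong: if_cong)
  finally have gram: "- (\<Sum>k\<in>?I. \<Sum>l\<in>?I. M k l * ip (K k) (K l))
      \<le> (\<Sum>k\<in>?I. r (fst k) * w k * ip (K k) (K k))"
    by simp

  \<comment> \<open>Each single stage dissipates: coercivity outweighs the share of that stage in the Gram bound.\<close>
  have dissip: "2 * (w k * ip (K k) (W k)) + h * (r (fst k) * w k * ip (K k) (K k)) \<le> 0"
    if stage_k: "k \<in> ?I" for k
  proof -
    obtain q i where k: "k = (q, i)" "q < N" "i < s q"
      using stage_k by (cases k) (auto simp: stages_def)
    have w: "0 \<le> w k"
      using assms(5) k by (simp add: nonneg_weights_def w_def)
    have KK: "0 \<le> ip (K k) (K k)"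
      using assms(2) bilinear_lzero[of ip]
      by (cases "K k = 0") (auto simp: is_scalar_product_def less_imp_le)
    have mu: "\<mu> q < 0" and "ip (K k) (W k) \<le> \<mu> q * (ip_norm ip (K k))\<^sup>2"
      using assms(3)[OF k(2)] by (auto simp: coercive_def K_def W_def k)
    moreover have "(ip_norm ip (K k))\<^sup>2 = ip (K k) (K k)"
      using KK by (simp add: ip_norm_def)
    ultimately have "ip (K k) (W k) \<le> \<mu> q * ip (K k) (K k)"
      by simp
    then have "2 * ip (K k) (W k) + h * r q * ip (K k) (K k)
        \<le> (2 * \<mu> q + h * r q) * ip (K k) (K k)"
      by (simp add: algebra_simps)
    also have "\<dots> \<le> 0"
      using step_bound_cleared[OF assms(9) k(2) assms(6)[OF k(2)] mu] KK
      by (intro mult_nonpos_nonneg) auto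
    finally have "w k * (2 * ip (K k) (W k) + h * r q * ip (K k) (K k)) \<le> 0"
      using w by (intro mult_nonneg_nonpos)
    then show ?thesis
      by (simp add: k algebra_simps)
  qed

  have "ip (z' - y') (z' - y') = ip (z - y) (z - y)
      + h * (2 * (\<Sum>k\<in>?I. w k * ip (K k) (W k))
        + h * (- (\<Sum>k\<in>?I. \<Sum>l\<in>?I. M k l * ip (K k) (K l))))"
    using energy_balance[OF assms(2) stage update]
    by (simp add: M_def power2_eq_square algebra_simps)
  also have "\<dots> \<le> ip (z - y) (z - y)
      + h * (2 * (\<Sum>k\<in>?I. w k * ip (K k) (W k))
        + h * (\<Sum>k\<in>?I. r (fst k) * w k * ip (K k) (K k)))"
    using gram assms(8) by (intro add_left_mono mult_left_mono) auto
  also have "\<dots> = ip (z - y) (z - y)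
      + h * (\<Sum>k\<in>?I. 2 * (w k * ip (K k) (W k)) + h * (r (fst k) * w k * ip (K k) (K k)))"
    by (simp add: sum.distrib sum_distrib_left)
  also have "\<dots> \<le> ip (z - y) (z - y)"
    using assms(8) sum_nonpos[of ?I, OF dissip] by (simp add: mult_nonneg_nonpos)
  finally show ?thesis
    by (simp add: ip_norm_def)
qed

end
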